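(* The $Q$-branch exists precisely for $n\equiv 3\pmod 4$ (i.e., $n=7,11,15,\dots$). For $n\equiv 1\pmod 4$ (e.g., $n=5,9,13,\dots$) it cannot occur, since $n=4m-1$ has no integer solution $m$. In particular: at degree $9$ only the triangular branch exists; at degree $11$ both the triangular branch and the $Q$-branch exist (the latter with $m=3$). In degree $7$ the two branches are not linearly equivalent.
   Context: The planar polynomial Hamiltonian system generated by $\mathcal{H}\in\mathbb{R}[x,y]$ (with $\mathcal{H}(0,0)=0$) is $\dot x=-\mathcal{H}_y$, $\dot y=\mathcal{H}_x$; $n$ denotes the degree of the system. An isochronous center of period $2\pi$ at the origin is called trivial if $\mathcal{H}=\tfrac12(f_1^2+f_2^2)$ for some polynomial map $f=(f_1,f_2):\mathbb{R}^2\to\mathbb{R}^2$ with $\det Df\equiv1$ ($Df$ the Jacobian matrix) and $f(0,0)=(0,0)$. Two families of trivial isochronous centers, given by such maps $f$ with real parameters, are considered. Triangular branch, in degree $n=2k-1$ with $k\ge2$ an integer: $f_1=x+\sum_{i=2}^{k}c_i y^i$, $f_2=y+\lambda f_1$. $Q$-branch, in degree $n=4m-1$ with $m\ge2$ an integer: $Q=y+\Gamma x^2$ with $\Gamma\neq0$, $f_1=x+\sum_{i=1}^{m}\beta_i Q^i$, $f_2=Q+\lambda f_1$. In degree $7$ the two branches are therefore the triangular branch with $k=4$ and the $Q$-branch with $m=2$. Two branches are linearly equivalent if they can be transformed into each other by linear changes of the variables. *)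

theory Defs
  imports "HOL-Analysis.Analysis" "HOL-Computational_Algebra.Polynomial"
begin

text \<open>
  A polynomial in x, y is an element of R[x][y]: the outer variable is y and the
  coefficients are polynomials in x.
\<close>

type_synonym bipoly = "real poly poly"

definition const :: "real \<Rightarrow> bipoly" where
  "const a = [:[:a:]:]"

definition X :: bipoly where
  "X = [:[:0, 1:]:]"

definition Y :: bipoly where
  "Y = [:0, 1:]"

definition eval2 :: "bipoly \<Rightarrow> real \<times> real \<Rightarrow> real" where
  "eval2 p z = poly (poly p [:snd z:]) (fst z)"

definition dx :: "bipoly \<Rightarrow> bipoly" where
  "dx p = map_poly pderiv p"

definition dy :: "bipoly \<Rightarrow> bipoly" where
  "dy p = pderiv p"

definition total_degree :: "bipoly \<Rightarrow> nat" where
  "total_degree p =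
     (if p = 0 then 0 else Max {i + j | i j. coeff (coeff p j) i \<noteq> 0})"

type_synonym planar_system = "bipoly \<times> bipoly"

definition hamiltonian_system :: "bipoly \<Rightarrow> planar_system" where
  "hamiltonian_system H = (- dy H, dx H)"

definition system_degree :: "planar_system \<Rightarrow> nat" where
  "system_degree F = max (total_degree (fst F)) (total_degree (snd F))"

definition vector_field :: "planar_system \<Rightarrow> real \<times> real \<Rightarrow> real \<times> real" where
  "vector_field F z = (eval2 (fst F) z, eval2 (snd F) z)"

definition is_solution :: "planar_system \<Rightarrow> (real \<Rightarrow> real \<times> real) \<Rightarrow> bool" where
  "is_solution F z \<longleftrightarrow>
     (\<forall>t. (z has_vector_derivative vector_field F (z t)) (at t))"

definition has_minimal_period :: "(real \<Rightarrow> real \<times> real) \<Rightarrow> real \<Rightarrow> bool" where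
  "has_minimal_period z T \<longleftrightarrow>
     T > 0 \<and> (\<forall>t. z (t + T) = z t) \<and> (\<forall>s. 0 < s \<and> s < T \<longrightarrow> (\<exists>t. z (t + s) \<noteq> z t))"

definition isochronous_center :: "real \<Rightarrow> planar_system \<Rightarrow> bool" where
  "isochronous_center T F \<longleftrightarrow>
     vector_field F (0, 0) = (0, 0) \<and>
     (\<exists>U. open U \<and> (0, 0) \<in> U \<and>
        (\<forall>p \<in> U - {(0, 0)}. \<exists>z. is_solution F z \<and> z 0 = p \<and> has_minimal_period z T))"

definition jacobian_det :: "bipoly \<times> bipoly \<Rightarrow> bipoly" where
  "jacobian_det f = dx (fst f) * dy (snd f) - dy (fst f) * dx (snd f)"

definition trivialized_by :: "bipoly \<Rightarrow> bipoly \<times> bipoly \<Rightarrow> bool" where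
  "trivialized_by H f \<longleftrightarrow>
     H = const (1 / 2) * ((fst f)\<^sup>2 + (snd f)\<^sup>2) \<and>
     jacobian_det f = 1 \<and>
     eval2 (fst f) (0, 0) = 0 \<and> eval2 (snd f) (0, 0) = 0"

text \<open>
  The trivial isochronous centers of period 2 pi and degree n whose trivializing
  map can be taken from a given set of maps, each represented by its Hamiltonian.
\<close>

definition trivial_centers :: "nat \<Rightarrow> (bipoly \<times> bipoly) set \<Rightarrow> bipoly set" where
  "trivial_centers n M =
     {H. isochronous_center (2 * pi) (hamiltonian_system H) \<and>
         (\<exists>f\<in>M. trivialized_by H f) \<and>
         system_degree (hamiltonian_system H) = n}"

definition triangular_map :: "nat \<Rightarrow> (nat \<Rightarrow> real) \<Rightarrow> real \<Rightarrow> bipoly \<times> bipoly" where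
  "triangular_map k c lam =
     (let f1 = X + (\<Sum>i = 2..k. const (c i) * Y ^ i)
      in (f1, Y + const lam * f1))"

definition Q_map :: "nat \<Rightarrow> real \<Rightarrow> (nat \<Rightarrow> real) \<Rightarrow> real \<Rightarrow> bipoly \<times> bipoly" where
  "Q_map m \<Gamma> \<beta> lam =
     (let Q = Y + const \<Gamma> * X\<^sup>2;
          f1 = X + (\<Sum>i = 1..m. const (\<beta> i) * Q ^ i)
      in (f1, Q + const lam * f1))"

text \<open>
  Fixing the degree forces the leading coefficient, c k respectively \<beta> m, to be
  nonzero.
\<close>

definition triangular_family :: "nat \<Rightarrow> bipoly set" where
  "triangular_family k =
     trivial_centers (2 * k - 1) {triangular_map k c lam | c lam. True}"

definition Q_family :: "nat \<Rightarrow> bipoly set" where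
  "Q_family m =
     trivial_centers (4 * m - 1) {Q_map m \<Gamma> \<beta> lam | \<Gamma> \<beta> lam. \<Gamma> \<noteq> 0}"

definition triangular_branch :: "nat \<Rightarrow> bipoly set" where
  "triangular_branch n = (\<Union>k\<in>{k. 2 \<le> k \<and> n = 2 * k - 1}. triangular_family k)"

definition Q_branch :: "nat \<Rightarrow> bipoly set" where
  "Q_branch n = (\<Union>m\<in>{m. 2 \<le> m \<and> n = 4 * m - 1}. Q_family m)"

text \<open>
  The substitution z = L w turns the system z' = F z into w' = G w, where
  G w is the preimage of F (L w) under L.
\<close>

definition linearly_conjugate :: "planar_system \<Rightarrow> planar_system \<Rightarrow> bool" where
  "linearly_conjugate F G \<longleftrightarrow>
     (\<exists>L. linear L \<and> bij L \<and> (\<forall>w. L (vector_field G w) = vector_field F (L w)))"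

definition linearly_equivalent :: "bipoly set \<Rightarrow> bipoly set \<Rightarrow> bool" where
  "linearly_equivalent B C \<longleftrightarrow>
     (\<forall>H\<in>B. \<exists>K\<in>C. linearly_conjugate (hamiltonian_system H) (hamiltonian_system K)) \<and>
     (\<forall>K\<in>C. \<exists>H\<in>B. linearly_conjugate (hamiltonian_system K) (hamiltonian_system H))"

end

theory Submission
  imports Defs
begin

text \<open>
  The statements on degrees are arithmetic once every admissible degree is shown to be
  attained. A witness for both families is the map \<open>f = (x + Q\<^sup>m, Q)\<close> with
  \<open>Q = y + g x\<^sup>2\<close>: for \<open>g = 0\<close> it is a triangular map, for \<open>g = 1\<close> a \<open>Q\<close>-map. It has
  the polynomial inverse \<open>(u, v) \<mapsto> (u - v\<^sup>m, v - g (u - v\<^sup>m)\<^sup>2)\<close> and, as its Jacobian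
  determinant is 1, it conjugates the Hamiltonian system of \<open>(f\<^sub>1\<^sup>2 + f\<^sub>2\<^sup>2) / 2\<close> to
  the linear rotation \<open>u' = - v\<close>, \<open>v' = u\<close>. So all orbits except the origin have minimal
  period \<open>2 \<pi>\<close> (\<open>isochronous_center_shear\<close>). That the degree is exactly the required one
  follows from an upper bound on total degrees and the degree of the restriction to an axis.

  For the inequivalence, let \<open>k = 2 m\<close>, the case in which the two families have the same
  degree \<open>4 m - 1\<close>. A triangular \<open>f\<close> has \<open>\<partial>f\<^sub>1/\<partial>x = 1\<close> and
  \<open>\<partial>f\<^sub>2/\<partial>x = \<lambda>\<close>, so the second component \<open>H\<^sub>x\<close> of the triangular
  field has degree at most \<open>2 m\<close>, far below the degree of the system. A linear conjugacy
  turns this component into a nontrivial linear combination of the two components of the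
  \<open>Q\<close>-field. But on the \<open>x\<close>-axis, where \<open>Q = \<Gamma> x\<^sup>2\<close> with \<open>\<Gamma> \<noteq> 0\<close>, these components
  are polynomials in \<open>x\<close> of the distinct degrees \<open>4 m - 2\<close> and \<open>4 m - 1\<close>
  (\<open>degree_Q_map_components\<close>), so every nontrivial combination has degree at least
  \<open>4 m - 2 > 2 m\<close>. Degree 7 is the case \<open>m = 2\<close>.
\<close>

section \<open>Evaluation and partial derivatives\<close>

lemma eval2_add [simp]: "eval2 (p + q) z = eval2 p z + eval2 q z"
  and eval2_minus [simp]: "eval2 (- p) z = - eval2 p z"
  and eval2_diff [simp]: "eval2 (p - q) z = eval2 p z - eval2 q z"
  and eval2_mult [simp]: "eval2 (p * q) z = eval2 p z * eval2 q z"
  and eval2_power [simp]: "eval2 (p ^ n) z = eval2 p z ^ n"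
  and eval2_0 [simp]: "eval2 0 z = 0"
  and eval2_1 [simp]: "eval2 1 z = 1"
  and eval2_const [simp]: "eval2 (const a) z = a"
  and eval2_X [simp]: "eval2 X z = fst z"
  and eval2_Y [simp]: "eval2 Y z = snd z"
  by (simp_all add: eval2_def const_def X_def Y_def poly_power)

lemma eval2_sum [simp]: "eval2 (sum f A) z = (\<Sum>i\<in>A. eval2 (f i) z)"
  by (induction A rule: infinite_finite_induct) simp_all

lemma eval2_numeral [simp]: "eval2 (numeral n) z = numeral n"
  by (simp add: eval2_def)

lemma pderiv_sum: "pderiv (sum f A) = (\<Sum>i\<in>A. pderiv (f i))"
  by (induction A rule: infinite_finite_induct) (simp_all add: pderiv_add)

lemma coeff_dx: "coeff (dx p) j = pderiv (coeff p j)"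
  by (simp add: dx_def coeff_map_poly)

lemma dx_add [simp]: "dx (p + q) = dx p + dx q"
  by (rule poly_eqI) (simp add: coeff_dx pderiv_add)

lemma dx_mult [simp]: "dx (p * q) = p * dx q + dx p * q"
  by (rule poly_eqI)
     (simp add: coeff_dx coeff_mult pderiv_sum pderiv_mult sum.distrib mult.commute[of "pderiv _"])

lemma dx_const [simp]: "dx (const a) = 0"
  and dx_X [simp]: "dx X = 1"
  and dx_Y [simp]: "dx Y = 0"
  and dx_0 [simp]: "dx 0 = 0"
  and dx_1 [simp]: "dx 1 = 0"
  by (rule poly_eqI;
      simp add: coeff_dx const_def X_def Y_def coeff_pCons pderiv_pCons coeff_1 split: nat.split)+

lemma dy_add [simp]: "dy (p + q) = dy p + dy q"
  and dy_mult [simp]: "dy (p * q) = p * dy q + dy p * q"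
  and dy_const [simp]: "dy (const a) = 0"
  and dy_X [simp]: "dy X = 0"
  and dy_Y [simp]: "dy Y = 1"
  and dy_0 [simp]: "dy 0 = 0"
  and dy_1 [simp]: "dy 1 = 0"
  by (simp_all add: dy_def const_def X_def Y_def pderiv_add pderiv_mult pderiv_pCons mult.commute)

lemma dx_sum [simp]: "dx (sum f A) = (\<Sum>i\<in>A. dx (f i))"
  by (induction A rule: infinite_finite_induct) simp_all

lemma dy_sum [simp]: "dy (sum f A) = (\<Sum>i\<in>A. dy (f i))"
  by (induction A rule: infinite_finite_induct) simp_all

lemma const_add: "const (a + b) = const a + const b"
  and const_0 [simp]: "const 0 = 0"
  and const_1 [simp]: "const 1 = 1"
  by (simp_all add: const_def one_pCons)

lemma const_numeral [simp]: "const (numeral n) = numeral n"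
  by (simp add: const_def numeral_poly)

lemma const_of_nat: "const (real n) = of_nat n"
  by (induction n) (simp_all add: const_add)

lemma dx_power [simp]: "dx (p ^ n) = const (real n) * p ^ (n - 1) * dx p"
proof (induction n)
  case (Suc n)
  then show ?case by (cases n) (simp_all add: const_add const_of_nat algebra_simps)
qed simp

lemma dy_power [simp]: "dy (p ^ n) = const (real n) * p ^ (n - 1) * dy p"
proof (induction n)
  case (Suc n)
  then show ?case by (cases n) (simp_all add: const_add const_of_nat algebra_simps)
qed simp

lemma const_half: "const (1 / 2) * (a + a) = a"
proof -
  have "const (1 / 2) * (a + a) = const (1 / 2 + 1 / 2) * a"
    unfolding const_add by (simp add: algebra_simps)
  then show ?thesis by simp
qed

text \<open>The Hamiltonian trivialized by \<open>f\<close>, when \<open>det Df = 1\<close> and \<open>f(0, 0) = (0, 0)\<close>.\<close>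

abbreviation energy :: "bipoly \<times> bipoly \<Rightarrow> bipoly" where
  "energy f \<equiv> const (1 / 2) * ((fst f)\<^sup>2 + (snd f)\<^sup>2)"

lemma dx_energy: "dx (energy f) = fst f * dx (fst f) + snd f * dx (snd f)"
proof -
  have "dx (energy f) = const (1 / 2) * ((fst f * dx (fst f) + snd f * dx (snd f))
      + (fst f * dx (fst f) + snd f * dx (snd f)))"
    by (simp add: power2_eq_square algebra_simps del: dx_power)
  then show ?thesis by (simp only: const_half)
qed

lemma dy_energy: "dy (energy f) = fst f * dy (fst f) + snd f * dy (snd f)"
proof -
  have "dy (energy f) = const (1 / 2) * ((fst f * dy (fst f) + snd f * dy (snd f))
      + (fst f * dy (fst f) + snd f * dy (snd f)))"
    by (simp add: power2_eq_square algebra_simps del: dy_power)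
  then show ?thesis by (simp only: const_half)
qed

section \<open>Total degree\<close>

text \<open>
  The set of exponents in the definition of \<open>total_degree\<close> is finite and, for \<open>p \<noteq> 0\<close>,
  nonempty; so its \<open>Max\<close> is a genuine maximum, and the bounds below reduce to statements
  about single coefficients.
\<close>

lemma total_degree_le_iff:
  "total_degree p \<le> n \<longleftrightarrow> (\<forall>i j. coeff (coeff p j) i \<noteq> 0 \<longrightarrow> i + j \<le> n)"
proof (cases "p = 0")
  case False
  let ?S = "{i + j | i j. coeff (coeff p j) i \<noteq> 0}"
  have "?S \<subseteq> (\<Union>j\<le>degree p. (\<lambda>i. i + j) ` {..degree (coeff p j)})"
  proof clarify
    fix i j assume nz: "coeff (coeff p j) i \<noteq> 0"
    then have "coeff p j \<noteq> 0" by auto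
    then show "i + j \<in> (\<Union>j\<le>degree p. (\<lambda>i. i + j) ` {..degree (coeff p j)})"
      using nz by (auto intro!: bexI[of _ j] imageI simp: le_degree)
  qed
  then have fin: "finite ?S" by (rule finite_subset) auto
  have "coeff (coeff p (degree p)) (degree (lead_coeff p)) \<noteq> 0" using False by simp
  then have "?S \<noteq> {}" by blast
  then show ?thesis using fin False by (auto simp: total_degree_def)
qed (simp add: total_degree_def)

lemma le_total_degree: "coeff (coeff p j) i \<noteq> 0 \<Longrightarrow> i + j \<le> total_degree p"
  using total_degree_le_iff[of p "total_degree p"] by blast

lemma total_degree_add_le:
  assumes "total_degree p \<le> n" "total_degree q \<le> n"
  shows "total_degree (p + q) \<le> n"
  unfolding total_degree_le_iff
proof (intro allI impI)
  fix i j assume "coeff (coeff (p + q) j) i \<noteq> 0"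
  then have "coeff (coeff p j) i \<noteq> 0 \<or> coeff (coeff q j) i \<noteq> 0" by auto
  then show "i + j \<le> n" using assms le_total_degree order_trans by blast
qed

lemma total_degree_mult_le:
  assumes "total_degree p \<le> n" "total_degree q \<le> m"
  shows "total_degree (p * q) \<le> n + m"
  unfolding total_degree_le_iff
proof (intro allI impI)
  fix i j assume "coeff (coeff (p * q) j) i \<noteq> 0"
  then have "(\<Sum>b\<le>j. \<Sum>a\<le>i. coeff (coeff p b) a * coeff (coeff q (j - b)) (i - a)) \<noteq> 0"
    by (simp add: coeff_mult coeff_sum)
  then obtain b where b: "b \<le> j"
    "(\<Sum>a\<le>i. coeff (coeff p b) a * coeff (coeff q (j - b)) (i - a)) \<noteq> 0"
    by (metis (no_types, lifting) atMost_iff sum.neutral)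
  then obtain a where a: "a \<le> i" "coeff (coeff p b) a * coeff (coeff q (j - b)) (i - a) \<noteq> 0"
    by (metis (no_types, lifting) atMost_iff sum.neutral)
  then have "a + b \<le> n" "(i - a) + (j - b) \<le> m"
    using assms le_total_degree order_trans by fastforce+
  then show "i + j \<le> n + m" using a b by linarith
qed

lemma total_degree_const [simp]: "total_degree (const a) = 0"
  using total_degree_le_iff[of "const a" 0]
  by (auto simp: const_def coeff_pCons split: nat.splits)

lemma total_degree_1 [simp]: "total_degree 1 = 0"
  using total_degree_const[of 1] by simp

lemma total_degree_X_le: "total_degree X \<le> 1"
  and total_degree_Y_le: "total_degree Y \<le> 1"
  by (auto simp: total_degree_le_iff X_def Y_def coeff_pCons coeff_1 split: nat.splits if_splits)

lemma total_degree_power_le: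
  "total_degree p \<le> n \<Longrightarrow> total_degree (p ^ k) \<le> n * k"
proof (induction k)
  case (Suc k)
  then show ?case using total_degree_mult_le[of p n "p ^ k" "n * k"] by simp
qed simp

lemma total_degree_const_mult_le: "total_degree p \<le> n \<Longrightarrow> total_degree (const a * p) \<le> n"
  using total_degree_mult_le[of "const a" 0 p n] by simp

lemma total_degree_sum_le:
  "(\<And>i. i \<in> A \<Longrightarrow> total_degree (f i) \<le> n) \<Longrightarrow> total_degree (sum f A) \<le> n"
  by (induction A rule: infinite_finite_induct)
    (auto intro!: total_degree_add_le simp: total_degree_def[of 0])

lemma total_degree_dx_le:
  assumes "total_degree p \<le> n" shows "total_degree (dx p) \<le> n - 1"
  unfolding total_degree_le_iff
proof (intro allI impI)
  fix i j assume "coeff (coeff (dx p) j) i \<noteq> 0"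
  then have "coeff (coeff p j) (Suc i) \<noteq> 0" by (simp add: coeff_dx coeff_pderiv)
  from le_total_degree[OF this] assms show "i + j \<le> n - 1" by simp
qed

lemma total_degree_dy_le:
  assumes "total_degree p \<le> n" shows "total_degree (dy p) \<le> n - 1"
  unfolding total_degree_le_iff
proof (intro allI impI)
  fix i j assume "coeff (coeff (dy p) j) i \<noteq> 0"
  then have "coeff (coeff p (Suc j)) i \<noteq> 0"
    by (auto simp: dy_def coeff_pderiv of_nat_poly simp del: of_nat_Suc)
  from le_total_degree[OF this] assms show "i + j \<le> n - 1" by simp
qed

lemma total_degree_uminus [simp]: "total_degree (- p) = total_degree p"
  by (simp add: total_degree_def)

lemma system_degree_energy_le:
  assumes "total_degree (fst f) \<le> n" "total_degree (snd f) \<le> n"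
  shows "system_degree (hamiltonian_system (energy f)) \<le> 2 * n - 1"
proof -
  have "total_degree (energy f) \<le> 2 * n"
    using assms[THEN total_degree_power_le, of 2]
    by (intro total_degree_const_mult_le total_degree_add_le) (simp_all add: mult.commute)
  then show ?thesis
    unfolding system_degree_def hamiltonian_system_def fst_conv snd_conv total_degree_uminus
    by (intro max.boundedI total_degree_dx_le total_degree_dy_le)
qed

section \<open>Restriction to a line through the origin\<close>

text \<open>
  The univariate polynomial \<open>s \<mapsto> p(a s, b s)\<close>. Restriction turns lower bounds on the total
  degree, and comparisons of polynomial functions, into questions on degrees in \<open>s\<close>.
\<close>

definition along :: "real \<Rightarrow> real \<Rightarrow> bipoly \<Rightarrow> real poly" where
  "along a b p = (\<Sum>j\<le>degree p. pcompose (coeff p j) [:0, a:] * [:0, b:] ^ j)"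

lemma poly_along: "poly (along a b p) s = eval2 p (s * a, s * b)"
  by (simp add: along_def eval2_def poly_sum poly_pcompose poly_altdef[of p] poly_power)

lemma along_add [simp]: "along a b (p + q) = along a b p + along a b q"
  and along_mult [simp]: "along a b (p * q) = along a b p * along a b q"
  and along_power [simp]: "along a b (p ^ n) = along a b p ^ n"
  and along_const [simp]: "along a b (const c) = [:c:]"
  and along_1 [simp]: "along a b 1 = 1"
  and along_X [simp]: "along a b X = [:0, a:]"
  and along_Y [simp]: "along a b Y = [:0, b:]"
  and along_sum [simp]: "along a b (sum f A) = (\<Sum>i\<in>A. along a b (f i))"
  by (rule poly_ext; simp add: poly_along poly_power poly_sum)+

lemma degree_along_le: "degree (along a b p) \<le> total_degree p"
  unfolding along_def
proof (intro degree_sum_le)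
  fix j
  have "degree (pcompose (coeff p j) [:0, a:] * [:0, b:] ^ j) \<le> total_degree p"
  proof (cases "coeff p j = 0")
    case False
    have "degree (pcompose (coeff p j) [:0, a:] * [:0, b:] ^ j)
        \<le> degree (pcompose (coeff p j) [:0, a:]) + degree ([:0, b:] ^ j)"
      by (rule degree_mult_le)
    also have "\<dots> \<le> degree (coeff p j) + j"
    proof (rule add_mono)
      show "degree (pcompose (coeff p j) [:0, a:]) \<le> degree (coeff p j)"
        using degree_pcompose_le[of "coeff p j" "[:0, a:]"] by (auto split: if_splits)
      show "degree ([:0, b:] ^ j) \<le> j"
        using degree_power_le[of "[:0, b:]" j] by (auto split: if_splits)
    qed
    also have "\<dots> \<le> total_degree p"
      using False by (intro le_total_degree) simp
    finally show ?thesis .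
  qed simp
  then show "degree (pcompose (coeff p j) [:0, a:] * [:0, b:] ^ j) \<le> total_degree p" .
qed simp

lemma along_x_axis: "along 1 0 p = coeff p 0"
  by (rule poly_ext) (simp add: poly_along eval2_def poly_0_coeff_0)

lemma along_x_axis_dx: "along 1 0 (dx p) = pderiv (along 1 0 p)"
  by (simp add: along_x_axis coeff_dx)

section \<open>A center in every admissible degree\<close>

definition shear :: "real \<Rightarrow> nat \<Rightarrow> bipoly \<times> bipoly" where
  "shear g m = (let Q = Y + const g * X\<^sup>2 in (X + Q ^ m, Q))"

lemma trivialized_by_shear:
  assumes "m > 0"
  shows "trivialized_by (energy (shear g m)) (shear g m)"
  using assms
  by (simp add: trivialized_by_def jacobian_det_def shear_def Let_def algebra_simps)

text \<open>
  Solutions are written down by pulling back the rotation \<open>(u, v)\<close> along the inverse of the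
  shear map; they exist for all times and all initial points, so the neighbourhood of the
  origin can be the whole plane. Injectivity of the shear map transfers the minimal period.
\<close>

lemma isochronous_center_shear:
  assumes "m > 0"
  shows "isochronous_center (2 * pi) (hamiltonian_system (energy (shear g m)))"
proof -
  let ?F = "hamiltonian_system (energy (shear g m))"
  have field: "vector_field ?F (x, y) =
     (let q = y + g * x\<^sup>2; u = x + q ^ m; r = - (real m * q ^ (m - 1) * u + q)
      in (r, u - 2 * g * x * r))" for x y
    unfolding vector_field_def hamiltonian_system_def fst_conv snd_conv dx_energy dy_energy
    by (simp add: shear_def Let_def algebra_simps power2_eq_square del: power_Suc)
  have "\<exists>z. is_solution ?F z \<and> z 0 = p \<and> has_minimal_period z (2 * pi)"
    if "p \<noteq> (0, 0)" for p
  proof -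
    \<comment> \<open>\<open>(a, b)\<close> is the image of the initial point under the shear map.\<close>
    define b where "b = snd p + g * (fst p)\<^sup>2"
    define a where "a = fst p + b ^ m"
    define u where "u t = a * cos t - b * sin t" for t
    define v where "v t = a * sin t + b * cos t" for t
    define x where "x t = u t - v t ^ m" for t
    define y where "y t = v t - g * (x t)\<^sup>2" for t
    let ?z = "\<lambda>t. (x t, y t)"
    have [derivative_intros]: "(u has_real_derivative - v t) (at t)" for t
      unfolding u_def v_def by (auto intro!: derivative_eq_intros)
    have [derivative_intros]: "(v has_real_derivative u t) (at t)" for t
      unfolding u_def v_def by (auto intro!: derivative_eq_intros)
    define r where "r t = - (real m * v t ^ (m - 1) * u t + v t)" for t
    have xd [derivative_intros]: "(x has_real_derivative r t) (at t)" for t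
      unfolding x_def r_def by (auto intro!: derivative_eq_intros)
    have yd: "(y has_real_derivative u t - 2 * g * x t * r t) (at t)" for t
      unfolding y_def by (auto intro!: derivative_eq_intros)
    have "is_solution ?F ?z"
      unfolding is_solution_def
    proof
      fix t
      have "vector_field ?F (?z t) = (r t, u t - 2 * g * x t * r t)"
        unfolding field by (simp add: y_def x_def r_def Let_def)
      then show "(?z has_vector_derivative vector_field ?F (?z t)) (at t)"
        using xd[of t] yd[of t]
        by (auto intro!: has_vector_derivative_Pair
            simp: has_real_derivative_iff_has_vector_derivative)
    qed
    moreover have "?z 0 = p"
      by (simp add: x_def y_def u_def v_def a_def b_def)
    moreover have "has_minimal_period ?z (2 * pi)"
      unfolding has_minimal_period_def
    proof (intro conjI allI impI)
      show "?z (t + 2 * pi) = ?z t" for t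
        by (simp add: x_def y_def u_def v_def)
      fix s :: real assume s: "0 < s \<and> s < 2 * pi"
      show "\<exists>t. ?z (t + s) \<noteq> ?z t"
      proof (rule ccontr)
        assume "\<nexists>t. ?z (t + s) \<noteq> ?z t"
        then have xy: "x s = x 0" "y s = y 0" by (metis Pair_inject add_0)+
        then have v: "v s = v 0" by (simp add: y_def)
        then have "u s = u 0" using xy by (simp add: x_def)
        with v have e: "a * cos s - b * sin s = a" "a * sin s + b * cos s = b"
          by (simp_all add: u_def v_def)
        \<comment> \<open>A nonzero vector fixed by the rotation through \<open>s\<close> forces \<open>cos s = 1\<close>.\<close>
        have "(a\<^sup>2 + b\<^sup>2) * cos s = a * (a * cos s - b * sin s) + b * (a * sin s + b * cos s)"
          by (simp add: power2_eq_square algebra_simps)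
        also have "\<dots> = a\<^sup>2 + b\<^sup>2" by (simp only: e) (simp add: power2_eq_square)
        finally have "(a\<^sup>2 + b\<^sup>2) * (cos s - 1) = 0" by (simp add: algebra_simps)
        moreover have "a\<^sup>2 + b\<^sup>2 \<noteq> 0"
        proof
          assume "a\<^sup>2 + b\<^sup>2 = 0"
          then have "a = 0" "b = 0" by (simp_all add: sum_power2_eq_zero_iff)
          then have "fst p = 0" using \<open>m > 0\<close> by (simp add: a_def power_0_left)
          moreover from this \<open>b = 0\<close> have "snd p = 0" by (simp add: b_def)
          ultimately show False using \<open>p \<noteq> (0, 0)\<close> by (simp add: prod_eq_iff)
        qed
        ultimately have "cos s = 1" by (metis eq_iff_diff_eq_0 mult_eq_0_iff)
        then obtain k :: int where k: "s = k * 2 * pi" by (auto simp: cos_one_2pi_int)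
        with s have "0 < k" "k < 1" by (simp_all add: zero_less_mult_iff)
        then show False by simp
      qed
    qed simp
    ultimately show ?thesis by blast
  qed
  moreover have "vector_field ?F (0, 0) = (0, 0)"
    using \<open>m > 0\<close> by (simp add: field Let_def)
  ultimately show ?thesis
    unfolding isochronous_center_def by (intro conjI exI[of _ UNIV]) auto
qed

lemma shear_eq_triangular_map:
  assumes "k \<ge> 2"
  shows "shear 0 k = triangular_map k (\<lambda>i. if i = k then 1 else 0) 0"
proof -
  have "(\<Sum>i = 2..k. const (if i = k then 1 else 0) * Y ^ i) = (\<Sum>i = 2..k. if i = k then Y ^ i else 0)"
    by (rule sum.cong) auto
  then show ?thesis using assms by (simp add: shear_def triangular_map_def)
qed

lemma shear_eq_Q_map:
  assumes "m \<ge> 1"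
  shows "shear g m = Q_map m g (\<lambda>i. if i = m then 1 else 0) 0"
proof -
  have "(\<Sum>i = 1..m. const (if i = m then 1 else 0) * q ^ i) = (\<Sum>i = 1..m. if i = m then q ^ i else 0)" for q
    by (rule sum.cong) auto
  then show ?thesis using assms by (simp add: shear_def Q_map_def Let_def)
qed

text \<open>
  The term of \<open>H\<^sub>y\<close> in \<open>y\<close> alone of exponent \<open>2 k - 1\<close>, visible on the \<open>y\<close>-axis, gives the
  exact degree.
\<close>

lemma triangular_family_nonempty:
  assumes "k \<ge> 2" shows "triangular_family k \<noteq> {}"
proof -
  let ?f = "shear 0 k"
  have upper: "system_degree (hamiltonian_system (energy ?f)) \<le> 2 * k - 1"
    using assms total_degree_Y_le total_degree_X_le total_degree_power_le[OF total_degree_Y_le, of k]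
    by (intro system_degree_energy_le) (auto simp: shear_def intro!: total_degree_add_le)
  have "along 0 1 (dy (energy ?f)) = monom (real k) (2 * k - 1) + monom 1 1"
    unfolding dy_energy
    by (rule poly_ext)
       (use assms in \<open>simp add: shear_def poly_monom poly_power flip: power_add mult_2\<close>)
  moreover have "degree (monom (real k) (2 * k - 1) + monom 1 1) = 2 * k - 1"
    using assms by (subst degree_add_eq_left) (auto simp: degree_monom_eq)
  ultimately have "2 * k - 1 \<le> total_degree (dy (energy ?f))"
    using degree_along_le[of 0 1 "dy (energy ?f)"] by simp
  then have "system_degree (hamiltonian_system (energy ?f)) = 2 * k - 1"
    using upper by (simp add: system_degree_def hamiltonian_system_def)
  then have "energy ?f \<in> triangular_family k"
    using assms isochronous_center_shear[of k 0] trivialized_by_shear[of k 0]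
      shear_eq_triangular_map[OF assms]
    unfolding triangular_family_def trivial_centers_def by fastforce
  then show ?thesis by blast
qed

section \<open>The Q-family restricted to the x-axis\<close>

text \<open>
  On the \<open>x\<close>-axis \<open>Q\<close> becomes \<open>q = \<Gamma> x\<^sup>2\<close>, so \<open>f\<^sub>1\<close> becomes \<open>u = x + P(q)\<close> of degree
  \<open>2 m\<close> and \<open>\<partial>f\<^sub>1/\<partial>y\<close> becomes \<open>w = P'(q)\<close> of degree \<open>2 m - 2\<close>, where
  \<open>P = \<Sum> \<beta>\<^sub>i t\<^sup>i\<close>. Then \<open>K\<close> is dominated by \<open>(1 + \<lambda>\<^sup>2) u\<^sup>2 / 2\<close> and
  \<open>K\<^sub>y\<close> by \<open>(1 + \<lambda>\<^sup>2) u w\<close>; the second domination rests on \<open>2 m < 4 m - 2\<close>.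
\<close>

lemma degree_Q_map_components:
  fixes lam :: real
  assumes m: "m \<ge> 2" and G: "G \<noteq> 0" and b: "\<beta> m \<noteq> 0"
  defines "K \<equiv> energy (Q_map m G \<beta> lam)"
  shows "degree (along 1 0 (dx K)) = 4 * m - 1" "degree (along 1 0 (dy K)) = 4 * m - 2"
proof -
  define P where "P = (\<Sum>i = 1..m. monom (\<beta> i) i)"
  define q where "q = [:0, 0, G:]"
  define u where "u = [:0, 1:] + pcompose P q"
  define w where "w = pcompose (pderiv P) q"
  have "degree P \<le> m"
    unfolding P_def by (rule degree_sum_le) (auto intro: order_trans[OF degree_monom_le])
  moreover have "coeff P m = \<beta> m"
    using m by (simp add: P_def coeff_sum)
  ultimately have dP: "degree P = m"
    using b le_degree[of P m] by simp
  have dq: "degree q = 2" using G by (simp add: q_def)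
  have dPq: "degree (pcompose P q) = 2 * m" by (simp add: degree_pcompose dP dq)
  have du: "degree u = 2 * m"
    unfolding u_def using m by (subst degree_add_eq_right) (auto simp: dPq)
  have dw: "degree w = 2 * m - 2" by (simp add: w_def degree_pcompose degree_pderiv dP dq)
  have nz: "u \<noteq> 0" "w \<noteq> 0" using du dw m by auto
  have fst_f: "along 1 0 (fst (Q_map m G \<beta> lam)) = u"
    by (rule poly_ext)
       (simp add: Q_map_def Let_def u_def P_def q_def poly_sum poly_pcompose poly_monom poly_power
         power2_eq_square algebra_simps)
  have snd_f: "along 1 0 (snd (Q_map m G \<beta> lam)) = q + smult lam u"
  proof -
    have "snd (Q_map m G \<beta> lam) = Y + const G * X\<^sup>2 + const lam * fst (Q_map m G \<beta> lam)"
      by (simp add: Q_map_def Let_def)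
    then show ?thesis by (simp add: fst_f q_def power2_eq_square)
  qed
  have dyfst: "along 1 0 (dy (fst (Q_map m G \<beta> lam))) = w"
    by (rule poly_ext)
       (simp add: Q_map_def Let_def w_def P_def q_def poly_sum poly_pcompose pderiv_sum pderiv_monom
         poly_monom poly_power power2_eq_square algebra_simps)
  have dysnd: "along 1 0 (dy (snd (Q_map m G \<beta> lam))) = 1 + smult lam w"
  proof -
    have "dy (snd (Q_map m G \<beta> lam)) = 1 + const lam * dy (fst (Q_map m G \<beta> lam))"
      by (simp add: Q_map_def Let_def)
    then show ?thesis by (simp add: dyfst)
  qed
  have pos: "1 + lam\<^sup>2 \<noteq> 0" by (smt (verit) zero_le_power2)
  have "along 1 0 K = smult ((1 + lam\<^sup>2) / 2) (u * u) + smult (1 / 2) (q * (smult (2 * lam) u + q))"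
    unfolding K_def
    by (rule poly_ext) (simp add: fst_f snd_f power2_eq_square field_simps)
  moreover have "degree (smult ((1 + lam\<^sup>2) / 2) (u * u)) = 4 * m"
    using pos nz du by (simp add: degree_mult_eq)
  moreover have "degree (smult (1 / 2) (q * (smult (2 * lam) u + q))) < 4 * m"
  proof -
    have "degree (smult (2 * lam) u + q) \<le> 2 * m"
      using m by (intro degree_add_le) (auto simp: du dq)
    then show ?thesis
      using m degree_mult_le[of q "smult (2 * lam) u + q"] dq by simp
  qed
  ultimately have "degree (along 1 0 K) = 4 * m" by (simp add: degree_add_eq_left)
  then show "degree (along 1 0 (dx K)) = 4 * m - 1"
    by (simp add: along_x_axis_dx degree_pderiv)
  have "along 1 0 (dy K) = smult (1 + lam\<^sup>2) (u * w) + (q * (1 + smult lam w) + smult lam u)"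
    unfolding K_def dy_energy
    by (rule poly_ext) (simp add: fst_f snd_f dyfst dysnd power2_eq_square algebra_simps)
  moreover have "degree (smult (1 + lam\<^sup>2) (u * w)) = 4 * m - 2"
    using pos nz du dw m by (simp add: degree_mult_eq)
  moreover have "degree (q * (1 + smult lam w) + smult lam u) < 4 * m - 2"
  proof -
    have "degree (1 + smult lam w) \<le> 2 * m - 2"
      by (intro degree_add_le) (auto simp: dw)
    then have "degree (q * (1 + smult lam w)) \<le> 2 * m"
      using m degree_mult_le[of q "1 + smult lam w"] dq by simp
    then have "degree (q * (1 + smult lam w) + smult lam u) \<le> 2 * m"
      by (intro degree_add_le) (auto simp: du)
    then show ?thesis using m by linarith
  qed
  ultimately show "degree (along 1 0 (dy K)) = 4 * m - 2" by (simp add: degree_add_eq_left)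
qed

text \<open>
  Besides the upper bound for arbitrary \<open>\<beta>\<close> in the case \<open>n = m\<close>, this shows that prescribing
  the degree \<open>4 m - 1\<close> forces \<open>\<beta>\<^sub>m \<noteq> 0\<close>, by the case \<open>n = m - 1\<close>.
\<close>

lemma system_degree_Q_map_le:
  assumes "n \<ge> 1" and "\<And>i. n < i \<Longrightarrow> i \<le> m \<Longrightarrow> \<beta> i = 0"
  shows "system_degree (hamiltonian_system (energy (Q_map m G \<beta> lam))) \<le> 4 * n - 1"
proof -
  define Q where "Q = Y + const G * X\<^sup>2"
  have Q: "total_degree Q \<le> 2"
    unfolding Q_def using total_degree_Y_le total_degree_power_le[OF total_degree_X_le, of 2]
    by (intro total_degree_add_le total_degree_const_mult_le) auto
  have "total_degree (const (\<beta> i) * Q ^ i) \<le> 2 * n" if "i \<in> {1..m}" for i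
  proof (cases "i \<le> n")
    case True
    then have "total_degree (Q ^ i) \<le> 2 * n"
      using total_degree_power_le[OF Q, of i] by linarith
    then show ?thesis by (rule total_degree_const_mult_le)
  next
    case False
    then show ?thesis using assms that by (simp add: total_degree_def)
  qed
  then have f: "total_degree (X + (\<Sum>i = 1..m. const (\<beta> i) * Q ^ i)) \<le> 2 * n"
    using assms(1) total_degree_X_le by (intro total_degree_add_le total_degree_sum_le) auto
  have "system_degree (hamiltonian_system (energy (Q_map m G \<beta> lam))) \<le> 2 * (2 * n) - 1"
    using f Q assms(1)
    by (intro system_degree_energy_le)
       (auto simp: Q_map_def Let_def simp flip: Q_def
         intro!: total_degree_add_le total_degree_const_mult_le)
  then show ?thesis by simp
qed

lemma Q_family_nonempty:
  assumes "m \<ge> 2" shows "Q_family m \<noteq> {}"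
proof -
  let ?\<beta> = "\<lambda>i. if i = m then 1 else 0 :: real"
  let ?f = "shear 1 m"
  have f: "?f = Q_map m 1 ?\<beta> 0" using assms by (intro shear_eq_Q_map) simp
  have "4 * m - 1 \<le> total_degree (dx (energy ?f))"
    using degree_along_le[of 1 0 "dx (energy ?f)"]
      degree_Q_map_components(1)[of m 1 ?\<beta> 0] assms by (simp add: f)
  moreover have "system_degree (hamiltonian_system (energy ?f)) \<le> 4 * m - 1"
    unfolding f using assms by (intro system_degree_Q_map_le) auto
  ultimately have "system_degree (hamiltonian_system (energy ?f)) = 4 * m - 1"
    by (simp add: system_degree_def hamiltonian_system_def)
  then have "energy ?f \<in> Q_family m"
    using assms isochronous_center_shear[of m 1] trivialized_by_shear[of m 1] f
    unfolding Q_family_def trivial_centers_def by (fastforce intro: one_neq_zero)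
  then show ?thesis by blast
qed

section \<open>Linear inequivalence\<close>

text \<open>
  For a triangular map \<open>H\<^sub>x = f\<^sub>1 + \<lambda> f\<^sub>2\<close>, since \<open>f\<^sub>1\<close> depends on \<open>x\<close> only through
  the summand \<open>x\<close>.
\<close>

lemma triangular_dx_degree_le:
  assumes "k \<ge> 1"
  shows "total_degree (dx (energy (triangular_map k c lam))) \<le> k"
proof -
  define f1 where "f1 = X + (\<Sum>i = 2..k. const (c i) * Y ^ i)"
  have "total_degree (const (c i) * Y ^ i) \<le> k" if "i \<in> {2..k}" for i
    using that total_degree_power_le[OF total_degree_Y_le, of i]
    by (intro total_degree_const_mult_le) auto
  then have f1: "total_degree f1 \<le> k"
    unfolding f1_def using assms total_degree_X_le
    by (intro total_degree_add_le total_degree_sum_le) auto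
  have "dx f1 = 1" by (simp add: f1_def)
  then have "dx (energy (triangular_map k c lam)) = f1 + const lam * (Y + const lam * f1)"
    unfolding dx_energy by (simp add: triangular_map_def Let_def algebra_simps flip: f1_def)
  then show ?thesis
    using f1 assms total_degree_Y_le
    by (auto intro!: total_degree_add_le total_degree_const_mult_le)
qed

text \<open>
  Let \<open>F\<close> and \<open>G\<close> be the vector fields of \<open>H\<close> and \<open>K\<close>, and take second components in
  \<open>L (G w) = F (L w)\<close>. The left side is a combination of the
  components of \<open>G\<close> with the coefficients in the second row of \<open>L\<close>, which is not zero; the
  right side is \<open>H\<^sub>x\<close> after a linear substitution, which does not raise the degree. The
  points \<open>w\<close> of the \<open>x\<close>-axis are mapped to a line through the origin.
\<close>

lemma conjugate_component_along_x_axis: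
  assumes "linearly_conjugate (hamiltonian_system H) (hamiltonian_system K)"
  obtains A B where "A \<noteq> 0 \<or> B \<noteq> 0"
    "degree (smult A (along 1 0 (dy K)) + smult B (along 1 0 (dx K))) \<le> total_degree (dx H)"
proof -
  obtain L where lin: "linear L" and bij: "bij L"
    and L: "\<And>w. L (vector_field (hamiltonian_system K) w) = vector_field (hamiltonian_system H) (L w)"
    using assms unfolding linearly_conjugate_def by blast
  define a b where "a = snd (L (1, 0))" and "b = snd (L (0, 1))"
  define c where "c = fst (L (1, 0))"
  have Lxy: "L (x, y) = x *\<^sub>R L (1, 0) + y *\<^sub>R L (0, 1)" for x y
  proof -
    have "L (x, y) = L (x *\<^sub>R (1, 0) + y *\<^sub>R (0, 1))" by simp
    then show ?thesis by (simp only: linear_add[OF lin] linear_scale[OF lin])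
  qed
  have snd_L: "snd (L (x, y)) = a * x + b * y" for x y
    using Lxy[of x y] by (simp add: a_def b_def)
  have "smult (- a) (along 1 0 (dy K)) + smult b (along 1 0 (dx K)) = along c a (dx H)"
  proof (rule poly_ext)
    fix s
    have "L (s, 0) = (s * c, s * a)"
      using Lxy[of s 0] by (simp add: a_def c_def prod_eq_iff)
    then show "poly (smult (- a) (along 1 0 (dy K)) + smult b (along 1 0 (dx K))) s
        = poly (along c a (dx H)) s"
      using arg_cong[OF L[of "(s, 0)"], of snd]
      by (simp add: poly_along vector_field_def hamiltonian_system_def snd_L)
  qed
  moreover have "- a \<noteq> 0 \<or> b \<noteq> 0"
  proof (rule ccontr)
    assume "\<not> (- a \<noteq> 0 \<or> b \<noteq> 0)"
    then have "snd (L w) = 0" for w using snd_L[of "fst w" "snd w"] by simp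
    moreover obtain w where "L w = (0, 1)" using bij_is_surj[OF bij] by (metis surjD)
    ultimately show False by (metis snd_conv zero_neq_one)
  qed
  ultimately show thesis using that degree_along_le by metis
qed

lemma triangular_not_conjugate_Q:
  assumes m: "m \<ge> 2" and H: "H \<in> triangular_family (2 * m)" and K: "K \<in> Q_family m"
  shows "\<not> linearly_conjugate (hamiltonian_system H) (hamiltonian_system K)"
proof
  assume "linearly_conjugate (hamiltonian_system H) (hamiltonian_system K)"
  then obtain A B where AB: "A \<noteq> 0 \<or> B \<noteq> 0"
    and deg: "degree (smult A (along 1 0 (dy K)) + smult B (along 1 0 (dx K))) \<le> total_degree (dx H)"
    by (rule conjugate_component_along_x_axis)
  obtain c lam where "H = energy (triangular_map (2 * m) c lam)"
    using H unfolding triangular_family_def trivial_centers_def trivialized_by_def by blast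
  then have H_deg: "total_degree (dx H) \<le> 2 * m"
    using triangular_dx_degree_le[of "2 * m" c lam] m by simp
  obtain G \<beta> mu where G: "G \<noteq> 0" and K_eq: "K = energy (Q_map m G \<beta> mu)"
    and K_deg: "system_degree (hamiltonian_system K) = 4 * m - 1"
    using K unfolding Q_family_def trivial_centers_def trivialized_by_def by blast
  have "\<beta> m \<noteq> 0"
  proof
    assume "\<beta> m = 0"
    then have "\<beta> i = 0" if "m - 1 < i" "i \<le> m" for i
      using that by (cases "i = m") auto
    then have "system_degree (hamiltonian_system K) \<le> 4 * (m - 1) - 1"
      unfolding K_eq using m by (intro system_degree_Q_map_le) auto
    then show False using K_deg m by linarith
  qed
  note degs = degree_Q_map_components[of m G \<beta> mu, OF m G this, folded K_eq]
  show False
  proof (cases "B = 0")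
    case True
    then show False using AB deg degs H_deg m by simp
  next
    case False
    have "degree (smult A (along 1 0 (dy K))) < degree (smult B (along 1 0 (dx K)))"
      using False degs m degree_smult_le[of A "along 1 0 (dy K)"] by simp
    then show False using False deg degs H_deg m by (simp add: degree_add_eq_right)
  qed
qed

section \<open>Degrees of the branches\<close>

lemma triangular_branch_odd:
  assumes "k \<ge> 2" shows "triangular_branch (2 * k - 1) = triangular_family k"
proof -
  have "{j. 2 \<le> j \<and> 2 * k - 1 = 2 * j - 1} = {k}" using assms by auto
  then show ?thesis by (simp add: triangular_branch_def)
qed

lemma Q_branch_eq:
  assumes "m \<ge> 2" shows "Q_branch (4 * m - 1) = Q_family m"
proof -
  have "{j. 2 \<le> j \<and> 4 * m - 1 = 4 * j - 1} = {m}" using assms by auto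
  then show ?thesis by (simp add: Q_branch_def)
qed

lemma Q_branch_nonempty_iff: "Q_branch n \<noteq> {} \<longleftrightarrow> 7 \<le> n \<and> n mod 4 = 3"
proof
  assume "Q_branch n \<noteq> {}"
  then obtain m where m: "m \<ge> 2" "n = 4 * m - 1" unfolding Q_branch_def by blast
  then have "n = 3 + 4 * (m - 1)" by simp
  moreover have "(3 + 4 * (m - 1)) mod 4 = 3" by (simp only: mod_mult_self2) simp
  ultimately show "7 \<le> n \<and> n mod 4 = 3" using m by simp
next
  assume n: "7 \<le> n \<and> n mod 4 = 3"
  then obtain j where "n = 4 * j + 3" using div_mult_mod_eq[of n 4] by (metis mult.commute)
  moreover define m where "m = j + 1"
  ultimately have "m \<ge> 2" "n = 4 * m - 1" using n by simp_all
  then show "Q_branch n \<noteq> {}" using Q_branch_eq[of m] Q_family_nonempty[of m] by simp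
qed

theorem corollary3p2:
  shows "(\<forall>n::nat. Q_branch n \<noteq> {} \<longleftrightarrow> 7 \<le> n \<and> n mod 4 = 3)
    \<and> (\<forall>n::nat. n mod 4 = 1 \<longrightarrow> (\<nexists>m::int. int n = 4 * m - 1) \<and> Q_branch n = {})
    \<and> (triangular_branch 9 \<noteq> {} \<and> Q_branch 9 = {})
    \<and> (triangular_branch 11 \<noteq> {} \<and> Q_branch 11 \<noteq> {} \<and> Q_branch 11 = Q_family 3)
    \<and> \<not> linearly_equivalent (triangular_branch 7) (Q_branch 7)
    \<and> (\<forall>H\<in>triangular_branch 7. \<forall>K\<in>Q_branch 7.
         \<not> linearly_conjugate (hamiltonian_system H) (hamiltonian_system K))"
proof -
  have T: "triangular_branch 7 = triangular_family 4"
    "triangular_branch 9 = triangular_family 5" "triangular_branch 11 = triangular_family 6"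
    using triangular_branch_odd[of 4] triangular_branch_odd[of 5] triangular_branch_odd[of 6]
    by simp_all
  have Q: "Q_branch 7 = Q_family 2" "Q_branch 11 = Q_family 3"
    using Q_branch_eq[of 2] Q_branch_eq[of 3] by simp_all
  have not_conj: "\<forall>H\<in>triangular_branch 7. \<forall>K\<in>Q_branch 7.
      \<not> linearly_conjugate (hamiltonian_system H) (hamiltonian_system K)"
    unfolding T Q using triangular_not_conjugate_Q[of 2] by simp
  moreover have "\<not> linearly_equivalent (triangular_branch 7) (Q_branch 7)"
    using not_conj triangular_family_nonempty[of 4] T
    unfolding linearly_equivalent_def by fastforce
  moreover have "\<forall>n::nat. n mod 4 = 1 \<longrightarrow> (\<nexists>m::int. int n = 4 * m - 1) \<and> Q_branch n = {}"
  proof (intro allI impI conjI)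
    fix n :: nat assume n: "n mod 4 = 1"
    then show "\<nexists>m::int. int n = 4 * m - 1" by presburger
    show "Q_branch n = {}" using n Q_branch_nonempty_iff[of n] by simp
  qed
  ultimately show ?thesis
    using Q_branch_nonempty_iff
    by (simp add: T Q triangular_family_nonempty Q_family_nonempty)
qed

end
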